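(* Let $G$ be a finite simple graph on $\{1,\ldots,r\}$, $r\ge1$, without isolated vertices, and let $J=J(G)$ be its cover ideal. Then $$\delta(J)=\max\left\{|N(S)|+\frac{|G\setminus N[S]|}{2} : S\in\Delta(G)\text{ and } G\setminus N[S]\text{ has no bipartite component}\right\}$$ $$=\frac r2+\max\left\{\frac{|N(S)|-|S|}{2} : S\in\Delta(G)\text{ and } G\setminus N[S]\text{ has no bipartite component}\right\}.$$
   Context: The cover ideal of $G$ is $J(G)=\bigcap_{\{i,j\}\in E(G)}(x_i,x_j)\subseteq k[x_1,\ldots,x_r]$, $k$ a field. Let $\mathcal{SP}(J(G))=\{\mathbf x\in\mathbb R^r : x_i\ge0 \text{ for all } i,\ x_i+x_j\ge1 \text{ for all } \{i,j\}\in E(G)\}$ and $\delta(J(G))=\max\{|\mathbf v| : \mathbf v\text{ is a vertex of }\mathcal{SP}(J(G))\}$, where $|\mathbf v|=v_1+\cdots+v_r$. $\Delta(G)$ is the set of all independent sets of $G$ (including $\emptyset$). For $S\subseteq V(G)$, $N(S)=\{v\in V(G)\setminus S : \{u,v\}\in E(G)\text{ for some }u\in S\}$ and $N[S]=S\cup N(S)$. $G\setminus N[S]$ is the graph obtained by deleting the vertices in $N[S]$ and their incident edges, and $|G\setminus N[S]|$ is its number of vertices. "Bipartite component" means a connected component that is a bipartite graph; an isolated vertex counts as a bipartite component, and the graph with no vertices has no components. *)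

theory Defs
  imports "HOL-Analysis.Analysis"
begin

record 'a ugraph =
  verts :: "'a set"
  edges :: "'a set set"

definition simple_graph :: "'a ugraph \<Rightarrow> bool" where
  "simple_graph G \<longleftrightarrow> finite (verts G) \<and> (\<forall>e\<in>edges G. e \<subseteq> verts G \<and> card e = 2)"

definition no_isolated_vertex :: "'a ugraph \<Rightarrow> bool" where
  "no_isolated_vertex G \<longleftrightarrow> (\<forall>v\<in>verts G. \<exists>e\<in>edges G. v \<in> e)"

definition induced_subgraph :: "'a ugraph \<Rightarrow> 'a set \<Rightarrow> 'a ugraph" where
  "induced_subgraph G W = \<lparr>verts = verts G \<inter> W, edges = {e \<in> edges G. e \<subseteq> W}\<rparr>"

definition delete_verts :: "'a ugraph \<Rightarrow> 'a set \<Rightarrow> 'a ugraph" where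
  "delete_verts G W = \<lparr>verts = verts G - W, edges = {e \<in> edges G. e \<inter> W = {}}\<rparr>"

definition indep_sets :: "'a ugraph \<Rightarrow> 'a set set" where
  "indep_sets G = {S. S \<subseteq> verts G \<and> (\<forall>u\<in>S. \<forall>v\<in>S. {u, v} \<notin> edges G)}"

definition nbhd :: "'a ugraph \<Rightarrow> 'a set \<Rightarrow> 'a set" where
  "nbhd G S = {v \<in> verts G - S. \<exists>u\<in>S. {u, v} \<in> edges G}"

definition closed_nbhd :: "'a ugraph \<Rightarrow> 'a set \<Rightarrow> 'a set" where
  "closed_nbhd G S = S \<union> nbhd G S"

definition reachability :: "'a ugraph \<Rightarrow> ('a \<times> 'a) set" where
  "reachability G = {(u, v). {u, v} \<in> edges G}\<^sup>* \<inter> verts G \<times> verts G"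

definition connected_comps :: "'a ugraph \<Rightarrow> 'a ugraph set" where
  "connected_comps G = induced_subgraph G ` (verts G // reachability G)"

definition bipartite :: "'a ugraph \<Rightarrow> bool" where
  "bipartite G \<longleftrightarrow> (\<exists>A B. A \<union> B = verts G \<and> A \<inter> B = {} \<and>
     (\<forall>e\<in>edges G. \<exists>a\<in>A. \<exists>b\<in>B. e = {a, b}))"

definition has_bipartite_comp :: "'a ugraph \<Rightarrow> bool" where
  "has_bipartite_comp G \<longleftrightarrow> (\<exists>C\<in>connected_comps G. bipartite C)"

text \<open>
  The next two definitions are the polyhedron \<open>SP(J(G))\<close> and the number \<open>\<delta>(J(G))\<close> attached to the
  cover ideal \<open>J(G)\<close>. Both are given by the edges of \<open>G\<close> alone, so neither the ideal nor the ground
  field appears. They are meant for graphs whose vertex set is the whole index type \<open>'n\<close>,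
  so that the ambient space is \<open>\<real>\<^sup>r\<close> with \<open>r = CARD('n)\<close>. The vertices of a polyhedron are its
  extreme points.
\<close>

definition SP_cover :: "'n::finite ugraph \<Rightarrow> (real ^ 'n) set" where
  "SP_cover G = {x. (\<forall>i. 0 \<le> x $ i) \<and> (\<forall>i j. {i, j} \<in> edges G \<longrightarrow> 1 \<le> x $ i + x $ j)}"

definition delta_cover :: "'n::finite ugraph \<Rightarrow> real" where
  "delta_cover G = Max {(\<Sum>i\<in>UNIV. v $ i) | v. v extreme_point_of SP_cover G}"

end

theory Submission
  imports Defs
begin

text \<open>
  The vertices of \<open>SP(J(G))\<close> can be listed explicitly: they are the points that are \<open>0\<close> on \<open>S\<close>,
  \<open>1\<close> on \<open>N(S)\<close> and \<open>1/2\<close> elsewhere, where \<open>S\<close> runs over the independent sets for which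
  \<open>G \<setminus> N[S]\<close> has no bipartite component (\<open>extreme_point_SP_cover_iff\<close>). The coordinate sum of such a
  point is \<open>|N(S)| + |G \<setminus> N[S]|/2\<close>, so both sides of the first equation are maxima over the same
  set. The second equation is the count \<open>r = |S| + |N(S)| + |G \<setminus> N[S]|\<close>.

  A point \<open>x\<close> of a polyhedron is a vertex iff no nonzero direction \<open>d\<close> keeps all constraints that
  are tight at \<open>x\<close> tight (\<open>extreme_point_iff_tight_direction\<close>). For \<open>SP(J(G))\<close> this means \<open>d\<^sub>i = 0\<close>
  where \<open>x\<^sub>i = 0\<close>, and \<open>d\<^sub>i + d\<^sub>j = 0\<close> on the edges with \<open>x\<^sub>i + x\<^sub>j = 1\<close>.

  If \<open>x\<close> is a vertex, let \<open>S\<close> be its zero set. Raising by the same amount all coordinates above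
  \<open>1/2\<close> and lowering all those strictly between \<open>0\<close> and \<open>1/2\<close>, except where \<open>x\<^sub>i = 1\<close> is forced by
  a neighbour in \<open>S\<close>, is such a direction. It must therefore be zero, which says that \<open>x\<close> is the
  point described above.

  For the point belonging to an independent set \<open>S\<close>, the directions vanish on \<open>N[S]\<close>,
  and the remaining condition is \<open>d\<^sub>i + d\<^sub>j = 0\<close> along every edge of \<open>G \<setminus> N[S]\<close>. Such a \<open>d\<close> has
  constant absolute value on each component, and its signs are a bipartition wherever it is not
  zero. So nonzero directions exist exactly when there is a bipartite component
  (\<open>no_bipartite_comp_iff\<close>).
\<close>

section \<open>Bipartite components and alternating functions\<close>

text \<open>
  This is the fact that the unsigned incidence matrix of a graph has full column rank iff no
  component is bipartite.
\<close>

lemma no_bipartite_comp_iff: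
  assumes "simple_graph H"
  shows "\<not> has_bipartite_comp H \<longleftrightarrow>
    (\<forall>d::'a \<Rightarrow> real. (\<forall>u v. {u, v} \<in> edges H \<longrightarrow> d u + d v = 0) \<longrightarrow> (\<forall>i\<in>verts H. d i = 0))"
    (is "_ \<longleftrightarrow> ?R")
proof
  assume nb: "\<not> has_bipartite_comp H"
  show ?R
  proof (intro allI impI ballI, rule ccontr)
    fix d :: "'a \<Rightarrow> real" and i
    assume alt: "\<forall>u v. {u, v} \<in> edges H \<longrightarrow> d u + d v = 0" and i: "i \<in> verts H" and nz: "d i \<noteq> 0"
    define W where "W = reachability H `` {i}"
    have walk: "d j = d i \<or> d j = - d i" if "(i, j) \<in> {(u, v). {u, v} \<in> edges H}\<^sup>*" for j
      using that
    proof induction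
      case (step y z)
      then have "d y + d z = 0" using alt by auto
      with step.IH show ?case by auto
    qed simp
    have W: "d j = d i \<or> d j = - d i" "j \<in> verts H" if "j \<in> W" for j
      using that walk by (auto simp: W_def reachability_def)
    define A where "A = {j \<in> W. d j = d i}"
    define B where "B = {j \<in> W. d j = - d i}"
    have "bipartite (induced_subgraph H W)"
      unfolding bipartite_def
    proof (intro exI conjI ballI)
      show "A \<union> B = verts (induced_subgraph H W)"
        using W by (auto simp: A_def B_def induced_subgraph_def)
      show "A \<inter> B = {}" using nz by (auto simp: A_def B_def)
      fix e assume "e \<in> edges (induced_subgraph H W)"
      then have e: "e \<in> edges H" "e \<subseteq> W" by (auto simp: induced_subgraph_def)
      then have "card e = 2" using assms by (auto simp: simple_graph_def)
      then obtain u v where uv: "e = {u, v}" by (auto simp: card_2_iff)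
      then have sum: "d u + d v = 0" using alt e by auto
      have uvW: "u \<in> W" "v \<in> W" using e uv by auto
      show "\<exists>a\<in>A. \<exists>b\<in>B. e = {a, b}"
      proof (cases "d u = d i")
        case True
        then have "u \<in> A" "v \<in> B" using sum uvW by (auto simp: A_def B_def)
        then show ?thesis using uv by auto
      next
        case False
        then have "d u = - d i" using W(1)[OF uvW(1)] by auto
        then have "v \<in> A" "u \<in> B" using sum uvW by (auto simp: A_def B_def)
        then show ?thesis using uv by (auto simp: insert_commute)
      qed
    qed
    moreover have "induced_subgraph H W \<in> connected_comps H"
      using i by (auto simp: connected_comps_def W_def quotient_def)
    ultimately show False using nb by (auto simp: has_bipartite_comp_def)
  qed
next
  assume R: ?R
  show "\<not> has_bipartite_comp H"
  proof
    assume "has_bipartite_comp H"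
    then obtain i where i: "i \<in> verts H" and bip: "bipartite (induced_subgraph H (reachability H `` {i}))"
      by (auto simp: has_bipartite_comp_def connected_comps_def quotient_def)
    define W where "W = reachability H `` {i}"
    obtain A B where AB: "A \<union> B = verts H \<inter> W" "A \<inter> B = {}"
      and edge: "\<And>e. e \<in> edges H \<Longrightarrow> e \<subseteq> W \<Longrightarrow> \<exists>a\<in>A. \<exists>b\<in>B. e = {a, b}"
      using bip by (auto simp: bipartite_def induced_subgraph_def W_def)
    define d :: "'a \<Rightarrow> real" where "d j = (if j \<in> A then 1 else if j \<in> B then -1 else 0)" for j
    have closed: "v \<in> W" if "u \<in> W" "{u, v} \<in> edges H" for u v
    proof -
      have "v \<in> verts H" using that assms by (auto simp: simple_graph_def)
      then show ?thesis using that
        by (auto simp: W_def reachability_def intro: rtrancl_into_rtrancl)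
    qed
    have "d u + d v = 0" if uv: "{u, v} \<in> edges H" for u v
    proof (cases "u \<in> W")
      case True
      then have "{u, v} \<subseteq> W" using closed uv by auto
      then obtain a b where "a \<in> A" "b \<in> B" "{u, v} = {a, b}" using edge uv by blast
      then show ?thesis using AB(2) by (auto simp: d_def doubleton_eq_iff)
    next
      case False
      then have "v \<notin> W" using closed[of v u] uv by (auto simp: insert_commute)
      with False show ?thesis using AB(1) by (auto simp: d_def)
    qed
    then have "d i = 0" using R i by blast
    moreover have "i \<in> A \<union> B" using i AB(1) by (auto simp: W_def reachability_def)
    ultimately show False by (auto simp: d_def split: if_splits)
  qed
qed

lemma simple_graph_delete_verts:
  assumes "simple_graph G"
  shows "simple_graph (delete_verts G W)"
  using assms by (auto simp: simple_graph_def delete_verts_def)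

section \<open>Extreme points and tight directions\<close>

definition tight_direction :: "'n::finite ugraph \<Rightarrow> real ^ 'n \<Rightarrow> real ^ 'n \<Rightarrow> bool" where
  "tight_direction G x d \<longleftrightarrow> (\<forall>i. x $ i = 0 \<longrightarrow> d $ i = 0) \<and>
     (\<forall>i j. {i, j} \<in> edges G \<and> x $ i + x $ j = 1 \<longrightarrow> d $ i + d $ j = 0)"

text \<open>
  A constraint that is not tight at \<open>x\<close> survives every sufficiently small move, and there are only
  finitely many constraints.
\<close>

lemma tight_direction_small_move:
  assumes x: "x \<in> SP_cover G" and d: "tight_direction G x d"
  shows "\<forall>\<^sub>F e in at_right 0. x + e *\<^sub>R d \<in> SP_cover G"
proof -
  have move: "\<forall>\<^sub>F e in at_right 0. c \<le> p + e * q" if "c \<le> p" "p = c \<longrightarrow> q = 0" for c p q :: real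
  proof (cases "p = c")
    case False
    have "((\<lambda>e. p + e * q) \<longlongrightarrow> p + 0 * q) (at_right 0)" by (intro tendsto_intros)
    then have "\<forall>\<^sub>F e in at_right 0. c < p + e * q"
      using False that by (intro order_tendstoD) auto
    then show ?thesis by eventually_elim simp
  qed (use that in simp)
  have "\<forall>\<^sub>F e in at_right 0. \<forall>i. 0 \<le> x $ i + e * d $ i"
    using x d by (intro eventually_all_finite move) (auto simp: SP_cover_def tight_direction_def)
  moreover have "\<forall>\<^sub>F e in at_right 0. \<forall>i j. {i, j} \<in> edges G \<longrightarrow>
      1 \<le> (x $ i + x $ j) + e * (d $ i + d $ j)"
  proof (intro eventually_all_finite)
    fix i j
    show "\<forall>\<^sub>F e in at_right 0. {i, j} \<in> edges G \<longrightarrow> 1 \<le> (x $ i + x $ j) + e * (d $ i + d $ j)"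
      using x d move[of 1 "x $ i + x $ j" "d $ i + d $ j"]
      by (cases "{i, j} \<in> edges G") (auto simp: SP_cover_def tight_direction_def)
  qed
  ultimately show ?thesis
    by eventually_elim (auto simp: SP_cover_def algebra_simps)
qed

lemma extreme_point_iff_tight_direction:
  "x extreme_point_of SP_cover G \<longleftrightarrow>
     x \<in> SP_cover G \<and> (\<forall>d. tight_direction G x d \<longrightarrow> d = 0)"
proof
  assume ext: "x extreme_point_of SP_cover G"
  then have x: "x \<in> SP_cover G" by (simp add: extreme_point_of_def)
  show "x \<in> SP_cover G \<and> (\<forall>d. tight_direction G x d \<longrightarrow> d = 0)"
  proof (intro conjI x allI impI, rule ccontr)
    fix d assume d: "tight_direction G x d" and nz: "d \<noteq> 0"
    then have "tight_direction G x (- d)"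
      unfolding tight_direction_def vector_uminus_component by (metis minus_add_distrib neg_0_equal_iff_equal)
    with d x have "\<forall>\<^sub>F e in at_right 0. x + e *\<^sub>R d \<in> SP_cover G \<and> x + e *\<^sub>R (- d) \<in> SP_cover G \<and> 0 < e"
      by (intro eventually_conj tight_direction_small_move eventually_at_right_less)
    then obtain e where e: "x + e *\<^sub>R d \<in> SP_cover G" "x + e *\<^sub>R (- d) \<in> SP_cover G" "0 < e"
      using eventually_happens'[OF trivial_limit_at_right_real] by blast
    have "x + e *\<^sub>R d \<noteq> x + e *\<^sub>R (- d)"
    proof
      assume eq: "x + e *\<^sub>R d = x + e *\<^sub>R (- d)"
      have "d $ i = 0" for i
        using arg_cong[OF eq, of "\<lambda>y. y $ i"] e(3) by simp
      then show False using nz by (simp add: vec_eq_iff)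
    qed
    moreover have "x = midpoint (x + e *\<^sub>R d) (x + e *\<^sub>R (- d))"
      by (simp add: midpoint_def vec_eq_iff)
    ultimately have "x \<in> open_segment (x + e *\<^sub>R d) (x + e *\<^sub>R (- d))"
      by (metis midpoint_in_open_segment)
    then show False using ext e by (auto simp: extreme_point_of_def)
  qed
next
  assume R: "x \<in> SP_cover G \<and> (\<forall>d. tight_direction G x d \<longrightarrow> d = 0)"
  show "x extreme_point_of SP_cover G"
    unfolding extreme_point_of_def
  proof (intro conjI ballI notI)
    fix a b assume a: "a \<in> SP_cover G" and b: "b \<in> SP_cover G" and "x \<in> open_segment a b"
    then obtain u where u: "0 < u" "u < 1" and ne: "a \<noteq> b" and x: "x = (1 - u) *\<^sub>R a + u *\<^sub>R b"
      unfolding in_segment by blast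
    \<comment> \<open>An average with positive weights attains a lower bound only if both points attain it, so the
      constraints tight at \<open>x\<close> are tight all along the segment.\<close>
    have avg: "p = q" if "c \<le> p" "c \<le> q" "(1 - u) * p + u * q = c" for c p q :: real
    proof -
      have "(1 - u) * (p - c) + u * (q - c) = 0" using that(3) by (simp add: algebra_simps)
      moreover have "0 \<le> (1 - u) * (p - c)" "0 \<le> u * (q - c)" using that(1,2) u by simp_all
      ultimately have "(1 - u) * (p - c) = 0" "u * (q - c) = 0" by linarith+
      then show ?thesis using u by simp
    qed
    have "tight_direction G x (b - a)"
      unfolding tight_direction_def
    proof (intro conjI allI impI)
      fix i assume "x $ i = 0"
      then show "(b - a) $ i = 0" using a b avg[of 0 "a $ i" "b $ i"] by (auto simp: SP_cover_def x)
    next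
      fix i j assume ij: "{i, j} \<in> edges G \<and> x $ i + x $ j = 1"
      then have "(1 - u) * (a $ i + a $ j) + u * (b $ i + b $ j) = 1"
        by (simp add: x algebra_simps)
      then have "a $ i + a $ j = b $ i + b $ j"
        using avg[of 1 "a $ i + a $ j" "b $ i + b $ j"] a b ij by (auto simp: SP_cover_def)
      then show "(b - a) $ i + (b - a) $ j = 0" by simp
    qed
    then have "b - a = 0" using R by blast
    then show False using ne by simp
  qed (use R in blast)
qed

section \<open>The vertices of the polyhedron\<close>

definition half_integral_point :: "'n::finite ugraph \<Rightarrow> 'n set \<Rightarrow> real ^ 'n" where
  "half_integral_point G S = (\<chi> i. if i \<in> S then 0 else if i \<in> nbhd G S then 1 else 1/2)"

lemma half_integral_point_in_SP_cover:
  assumes "verts G = UNIV" "S \<in> indep_sets G"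
  shows "half_integral_point G S \<in> SP_cover G"
  using assms
  by (auto simp: SP_cover_def half_integral_point_def nbhd_def indep_sets_def insert_commute)

text \<open>
  On \<open>N(S)\<close> a direction vanishes because each vertex there has a tight edge into \<open>S\<close>. Off \<open>N[S]\<close>
  every edge inside \<open>G \<setminus> N[S]\<close> is tight, and no edge between \<open>G \<setminus> N[S]\<close> and \<open>N[S]\<close> is, since such
  an edge ends in \<open>N(S)\<close>.
\<close>

lemma tight_direction_half_integral_point_iff:
  assumes V: "verts G = UNIV" and S: "S \<in> indep_sets G"
  shows "tight_direction G (half_integral_point G S) d \<longleftrightarrow>
    (\<forall>i\<in>closed_nbhd G S. d $ i = 0) \<and>
    (\<forall>i j. {i, j} \<in> edges (delete_verts G (closed_nbhd G S)) \<longrightarrow> d $ i + d $ j = 0)"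
    (is "?L \<longleftrightarrow> ?R")
proof
  let ?x = "half_integral_point G S"
  assume L: ?L
  have dS: "d $ i = 0" if "i \<in> S" for i
    using L that by (auto simp: tight_direction_def half_integral_point_def)
  have "d $ i = 0" if i: "i \<in> nbhd G S" for i
  proof -
    obtain u where u: "u \<in> S" "{u, i} \<in> edges G" using i by (auto simp: nbhd_def)
    have "?x $ u + ?x $ i = 1" using i u by (auto simp: half_integral_point_def nbhd_def)
    then have "d $ u + d $ i = 0" using L u by (auto simp: tight_direction_def)
    then show ?thesis using dS u by simp
  qed
  moreover have "d $ i + d $ j = 0" if "{i, j} \<in> edges (delete_verts G (closed_nbhd G S))" for i j
  proof -
    have "{i, j} \<in> edges G" "?x $ i + ?x $ j = 1"
      using that by (auto simp: delete_verts_def closed_nbhd_def half_integral_point_def)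
    then show ?thesis using L by (auto simp: tight_direction_def)
  qed
  ultimately show ?R using dS by (auto simp: closed_nbhd_def)
next
  let ?x = "half_integral_point G S"
  assume R: ?R
  show ?L
    unfolding tight_direction_def
  proof (intro conjI allI impI)
    fix i assume "?x $ i = 0"
    then have "i \<in> S" by (auto simp: half_integral_point_def split: if_splits)
    then show "d $ i = 0" using R by (auto simp: closed_nbhd_def)
  next
    fix i j assume ij: "{i, j} \<in> edges G \<and> ?x $ i + ?x $ j = 1"
    have "{i, j} \<subseteq> closed_nbhd G S \<or> {i, j} \<inter> closed_nbhd G S = {}"
      using ij V by (auto simp: half_integral_point_def closed_nbhd_def nbhd_def insert_commute
          split: if_splits)
    then show "d $ i + d $ j = 0"
      using R ij by (auto simp: delete_verts_def)
  qed
qed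

lemma extreme_half_integral_point_iff:
  assumes G: "simple_graph G" and V: "verts G = UNIV" and S: "S \<in> indep_sets G"
  shows "half_integral_point G S extreme_point_of SP_cover G \<longleftrightarrow>
    \<not> has_bipartite_comp (delete_verts G (closed_nbhd G S))"
proof -
  let ?N = "closed_nbhd G S" and ?H = "delete_verts G (closed_nbhd G S)"
  have edges_H: "i \<notin> ?N \<and> j \<notin> ?N" if "{i, j} \<in> edges ?H" for i j
    using that by (auto simp: delete_verts_def)
  have verts_H: "verts ?H = - ?N" using V by (auto simp: delete_verts_def)
  have "half_integral_point G S extreme_point_of SP_cover G \<longleftrightarrow>
      (\<forall>d::real^'a. (\<forall>i\<in>?N. d $ i = 0) \<and> (\<forall>i j. {i, j} \<in> edges ?H \<longrightarrow> d $ i + d $ j = 0) \<longrightarrow> d = 0)"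
    using half_integral_point_in_SP_cover[OF V S]
    unfolding extreme_point_iff_tight_direction tight_direction_half_integral_point_iff[OF V S]
    by blast
  also have "\<dots> \<longleftrightarrow> (\<forall>d::'a \<Rightarrow> real. (\<forall>u v. {u, v} \<in> edges ?H \<longrightarrow> d u + d v = 0) \<longrightarrow>
      (\<forall>i\<in>verts ?H. d i = 0))" (is "?vec \<longleftrightarrow> ?fun")
  proof
    assume vec: ?vec
    show ?fun
    proof (intro allI impI ballI)
      fix d :: "'a \<Rightarrow> real" and i
      assume alt: "\<forall>u v. {u, v} \<in> edges ?H \<longrightarrow> d u + d v = 0" and i: "i \<in> verts ?H"
      define d' :: "real^'a" where "d' = (\<chi> i. if i \<in> ?N then 0 else d i)"
      have "(\<forall>i\<in>?N. d' $ i = 0) \<and> (\<forall>i j. {i, j} \<in> edges ?H \<longrightarrow> d' $ i + d' $ j = 0)"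
        using alt edges_H by (auto simp: d'_def)
      then have "d' = 0" using vec by blast
      then have "d' $ i = 0" by simp
      then show "d i = 0" using i verts_H by (simp add: d'_def)
    qed
  next
    assume "fun": ?fun
    show ?vec
    proof (intro allI impI)
      fix d :: "real^'a"
      assume d: "(\<forall>i\<in>?N. d $ i = 0) \<and> (\<forall>i j. {i, j} \<in> edges ?H \<longrightarrow> d $ i + d $ j = 0)"
      then have "\<forall>i\<in>verts ?H. d $ i = 0" using "fun" by blast
      then show "d = 0" using d verts_H by (auto simp: vec_eq_iff)
    qed
  qed
  also have "\<dots> \<longleftrightarrow> \<not> has_bipartite_comp ?H"
    using no_bipartite_comp_iff[OF simple_graph_delete_verts[OF G]] by blast
  finally show ?thesis .
qed

text \<open>
  The direction used here moves coordinates away from \<open>1/2\<close>. On a tight edge \<open>x\<^sub>i < 1/2\<close> pairs with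
  \<open>x\<^sub>j > 1/2\<close>, so the two moves cancel. The coordinates equal to \<open>1\<close> with a neighbour in the zero set
  stay put, as they pair with coordinates that cannot move.
\<close>

lemma extreme_point_eq_half_integral_point:
  assumes V: "verts G = UNIV" and ext: "x extreme_point_of SP_cover G"
  defines "S \<equiv> {i. x $ i = 0}"
  shows "S \<in> indep_sets G" and "x = half_integral_point G S"
proof -
  have nonneg: "0 \<le> x $ i" for i
    using ext by (simp add: extreme_point_of_def SP_cover_def)
  have cover: "1 \<le> x $ i + x $ j" if "{i, j} \<in> edges G" for i j
    using ext that by (simp add: extreme_point_of_def SP_cover_def)
  show indep: "S \<in> indep_sets G"
    using cover by (fastforce simp: indep_sets_def S_def V)
  have nbhd_ge: "1 \<le> x $ i" if "i \<in> nbhd G S" for i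
    using that cover by (fastforce simp: nbhd_def S_def)
  have nbhdI: "j \<in> nbhd G S" if "{i, j} \<in> edges G" "x $ i = 0" for i j
    using that cover[OF that(1)] by (auto simp: nbhd_def S_def V)
  define d :: "real^'a" where "d = (\<chi> i. if x $ i = 0 \<or> x $ i = 1/2 \<or> i \<in> nbhd G S \<and> x $ i = 1 then 0
    else if x $ i < 1/2 then -1 else 1)"
  have half: "d $ i + d $ j = 0" if ij: "{i, j} \<in> edges G" "x $ i + x $ j = 1" "x $ i \<le> 1/2" for i j
  proof -
    consider "x $ i = 0" | "0 < x $ i" "x $ i < 1/2" | "x $ i = 1/2"
      using nonneg[of i] ij(3) by linarith
    then show ?thesis
    proof cases
      case 1
      then show ?thesis using ij nbhdI by (auto simp: d_def)
    next
      case 2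
      then show ?thesis using ij by (auto simp: d_def)
    next
      case 3
      then show ?thesis using ij by (auto simp: d_def)
    qed
  qed
  have "tight_direction G x d"
    unfolding tight_direction_def
  proof (intro conjI allI impI)
    fix i j assume ij: "{i, j} \<in> edges G \<and> x $ i + x $ j = 1"
    show "d $ i + d $ j = 0"
    proof (cases "x $ i \<le> 1/2")
      case True
      then show ?thesis using half ij by blast
    next
      case False
      then have "d $ j + d $ i = 0" using ij by (intro half) (auto simp: insert_commute)
      then show ?thesis by simp
    qed
  qed (simp add: d_def)
  then have "d = 0" using ext extreme_point_iff_tight_direction by blast
  then have d0: "d $ i = 0" for i by simp
  have cases: "x $ i = 0 \<or> x $ i = 1/2 \<or> i \<in> nbhd G S \<and> x $ i = 1" for i
    using d0[of i] by (auto simp: d_def split: if_splits)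
  show "x = half_integral_point G S"
  proof (subst vec_eq_iff, intro allI)
    fix i
    show "x $ i = half_integral_point G S $ i"
      using cases[of i] nbhd_ge[of i] by (auto simp: half_integral_point_def S_def)
  qed
qed

theorem extreme_point_SP_cover_iff:
  assumes "simple_graph G" "verts G = UNIV"
  shows "x extreme_point_of SP_cover G \<longleftrightarrow>
    (\<exists>S. S \<in> indep_sets G \<and> \<not> has_bipartite_comp (delete_verts G (closed_nbhd G S)) \<and>
         x = half_integral_point G S)"
proof
  assume ext: "x extreme_point_of SP_cover G"
  define S where "S = {i. x $ i = 0}"
  have "S \<in> indep_sets G" "x = half_integral_point G S"
    unfolding S_def using extreme_point_eq_half_integral_point[OF assms(2) ext] by auto
  then show "\<exists>S. S \<in> indep_sets G \<and> \<not> has_bipartite_comp (delete_verts G (closed_nbhd G S)) \<and>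
         x = half_integral_point G S"
    using ext extreme_half_integral_point_iff[OF assms] by blast
qed (use extreme_half_integral_point_iff[OF assms] in blast)

section \<open>Coordinate sums\<close>

lemma verts_delete_closed_nbhd:
  assumes "verts G = UNIV"
  shows "verts (delete_verts G (closed_nbhd G S)) = - S - nbhd G S"
  using assms by (auto simp: delete_verts_def closed_nbhd_def)

lemma sum_half_integral_point:
  assumes "verts G = UNIV"
  shows "(\<Sum>i\<in>UNIV. half_integral_point G S $ i) =
    real (card (nbhd G S)) + real (card (verts (delete_verts G (closed_nbhd G S)))) / 2"
proof -
  have "(\<Sum>i\<in>UNIV. half_integral_point G S $ i) =
      (\<Sum>i\<in>UNIV. of_bool (i \<in> nbhd G S) + of_bool (i \<in> - S - nbhd G S) / 2)"
    by (rule sum.cong) (auto simp: half_integral_point_def nbhd_def)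
  also have "\<dots> = real (card (nbhd G S)) + real (card (- S - nbhd G S)) / 2"
    unfolding sum.distrib sum_divide_distrib[symmetric]
    by (simp only: sum_of_bool_eq finite Int_UNIV_left Collect_mem_eq)
  finally show ?thesis by (simp add: verts_delete_closed_nbhd[OF assms])
qed

lemma nbhd_plus_half_rest_eq:
  fixes G :: "'n::finite ugraph"
  assumes "verts G = UNIV"
  shows "real (card (nbhd G S)) + real (card (verts (delete_verts G (closed_nbhd G S)))) / 2 =
    real CARD('n) / 2 + (real (card (nbhd G S)) - real (card S)) / 2"
proof -
  have "CARD('n) = card (S \<union> nbhd G S \<union> (- S - nbhd G S))"
    by (rule arg_cong[of _ _ card]) auto
  also have "\<dots> = card (S \<union> nbhd G S) + card (- S - nbhd G S)"
    by (rule card_Un_disjoint) auto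
  also have "card (S \<union> nbhd G S) = card S + card (nbhd G S)"
    by (rule card_Un_disjoint) (auto simp: nbhd_def)
  finally show ?thesis
    by (simp add: verts_delete_closed_nbhd[OF assms] field_simps)
qed

text \<open>
  The maxima range over a nonempty set: a maximal independent set \<open>S\<close> is dominating, so that
  \<open>G \<setminus> N[S]\<close> has no components at all.
\<close>

lemma exists_indep_set_no_bipartite_comp:
  fixes G :: "'n::finite ugraph"
  assumes G: "simple_graph G" and V: "verts G = UNIV"
  shows "\<exists>S\<in>indep_sets G. \<not> has_bipartite_comp (delete_verts G (closed_nbhd G S))"
proof -
  have "{} \<in> indep_sets G" by (simp add: indep_sets_def)
  then obtain S where S: "S \<in> indep_sets G" and max: "\<And>T. T \<in> indep_sets G \<Longrightarrow> S \<subseteq> T \<Longrightarrow> S = T"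
    using finite_has_maximal[of "indep_sets G"] by fastforce
  have loop: "{i} \<notin> edges G" for i using G by (fastforce simp: simple_graph_def)
  have "i \<in> closed_nbhd G S" for i
  proof (rule ccontr)
    assume i: "i \<notin> closed_nbhd G S"
    then have "insert i S \<in> indep_sets G"
      using S loop by (auto simp: closed_nbhd_def nbhd_def indep_sets_def V insert_commute)
    then show False using max[of "insert i S"] i by (auto simp: closed_nbhd_def)
  qed
  then have "verts (delete_verts G (closed_nbhd G S)) = {}" by (auto simp: delete_verts_def)
  then show ?thesis
    using S by (intro bexI[of _ S]) (auto simp: has_bipartite_comp_def connected_comps_def)
qed

theorem theorem4p6:
  fixes G :: "'n::finite ugraph"
  assumes "simple_graph G" and "verts G = UNIV" and "no_isolated_vertex G"
  shows "delta_cover G =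
           Max {real (card (nbhd G S)) +
                real (card (verts (delete_verts G (closed_nbhd G S)))) / 2 | S.
                S \<in> indep_sets G \<and> \<not> has_bipartite_comp (delete_verts G (closed_nbhd G S))}
       \<and> Max {real (card (nbhd G S)) +
                real (card (verts (delete_verts G (closed_nbhd G S)))) / 2 | S.
                S \<in> indep_sets G \<and> \<not> has_bipartite_comp (delete_verts G (closed_nbhd G S))} =
         real CARD('n) / 2 +
           Max {(real (card (nbhd G S)) - real (card S)) / 2 | S.
                S \<in> indep_sets G \<and> \<not> has_bipartite_comp (delete_verts G (closed_nbhd G S))}"
proof
  let ?P = "\<lambda>S. S \<in> indep_sets G \<and> \<not> has_bipartite_comp (delete_verts G (closed_nbhd G S))"
  let ?f = "\<lambda>S. real (card (nbhd G S)) + real (card (verts (delete_verts G (closed_nbhd G S)))) / 2"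
  let ?g = "\<lambda>S. (real (card (nbhd G S)) - real (card S)) / 2"
  have "{(\<Sum>i\<in>UNIV. v $ i) | v. v extreme_point_of SP_cover G} = {?f S | S. ?P S}"
    unfolding extreme_point_SP_cover_iff[OF assms(1,2)] sum_half_integral_point[OF assms(2), symmetric]
    by blast
  then show "delta_cover G = Max {?f S | S. ?P S}" by (simp add: delta_cover_def)
  have "mono (\<lambda>y. real CARD('n) / 2 + y)" by (intro monoI add_left_mono)
  moreover have "finite {?g S | S. ?P S}" by (rule finite_image_set) simp
  moreover have "{?g S | S. ?P S} \<noteq> {}"
    using exists_indep_set_no_bipartite_comp[OF assms(1,2)] by blast
  ultimately have "real CARD('n) / 2 + Max {?g S | S. ?P S} =
      Max ((\<lambda>y. real CARD('n) / 2 + y) ` {?g S | S. ?P S})"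
    by (rule mono_Max_commute)
  also have "(\<lambda>y. real CARD('n) / 2 + y) ` {?g S | S. ?P S} = {?f S | S. ?P S}"
    unfolding nbhd_plus_half_rest_eq[OF assms(2)] by blast
  finally show "Max {?f S | S. ?P S} = real CARD('n) / 2 + Max {?g S | S. ?P S}" by (rule sym)
qed

end
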